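(* Fix $\hbar>0$. The set of Tate Rabinowitz quantized energy values $E>0$ for the harmonic oscillator is exactly $\{(n-\tfrac12)\hbar \mid n\in\mathbb{N}\}$, where $\mathbb{N}=\{1,2,3,\dots\}$.
   Context: Let $E>0$, $\kappa>0$. The Tate Rabinowitz Floer complex of the harmonic oscillator, i.e. of the functional $\mathfrak{A}^E_\kappa([v,\tau,w,\eta])=\mathcal{A}^{\mu_E}(v,\tau)+\mathcal{A}^{\mu_\kappa}(w,\eta)$ with $\mu_c(z)=\pi|z|^2-c$ on $\mathbb{C}$ and $\mathcal{A}^{H}(v,\tau)=\int_{S^1} v^*\lambda-\tau\int_0^1H(v(t))\,dt$ (where $\lambda=\tfrac12(x\,dy-y\,dx)$), is described as follows. The generators are symbols $u^+_{\nu,\ell},u^-_{\nu,\ell}$ with $(\nu,\ell)\in\mathbb{Z}\times\mathbb{Z}$ (maximum and minimum of a Morse function on the critical circle labelled by $(\nu,\ell)$), with degrees $|u^-_{\nu,\ell}|=2(\nu+\ell)$, $|u^+_{\nu,\ell}|=2(\nu+\ell)+1$ and action $\mathfrak{A}^E_\kappa(u^\pm_{\nu,\ell})=E\nu+\kappa\ell$. For $\nu\in\mathbb{Z}$, $C_{2\nu}$ is the abelian group of all doubly infinite formal sums $\sum_{\ell\in\mathbb{Z}}\xi_\ell u^-_{\nu-\ell,\ell}$ with $\xi_\ell\in\mathbb{Z}$, and $C_{2\nu+1}$ is the abelian group of all doubly infinite formal sums $\sum_{\ell\in\mathbb{Z}}\xi_\ell u^+_{\nu-\ell,\ell}$ with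 $\xi_\ell\in\mathbb{Z}$ (no finiteness condition on the coefficients). The boundary operator $\partial:C_k\to C_{k-1}$ is the extension to infinite sums of $\partial u^-_{\nu,\ell}=u^+_{\nu-1,\ell}+\nu\,u^+_{\nu,\ell-1}$, $\partial u^+_{\nu,\ell}=0$; that is, $\partial\big(\sum_\ell\xi_\ell u^-_{\nu-\ell,\ell}\big)=\sum_\ell\big(\xi_\ell+(\nu-\ell-1)\xi_{\ell+1}\big)u^+_{\nu-\ell-1,\ell}$. Let $H_k=H_k(\mathfrak{A}^E_\kappa)$ be its homology in degree $k$. The isomorphisms $\mathfrak{U}:C_k\to C_{k+2}$, $\mathfrak{U}(u^\pm_{\nu,\ell})=u^\pm_{\nu,\ell+1}$ (extended to infinite sums), commute with $\partial$ and induce isomorphisms $\mathfrak{u}:H_k\to H_{k+2}$. This gives an action of the group $\mathbb{Z}$ on homology; the $\mathbb{Z}[\mathbb{Z}]$-equivalence class of $\alpha$ is $\{\mathfrak{u}^j\alpha\mid j\in\mathbb{Z}\}$. Shifted action: $\widetilde{\mathfrak{A}}^E_\kappa(u^+_{\nu,\ell})=E\nu+\kappa\ell+\tfrac{\nu\hbar}{2}$. For a nonzero chain $\xi=\sum_\ell\xi_\ell u^+_{\nu-\ell,\ell}\in C_{2\nu+1}$ put $\sigma(\xi)=\sup\{\widetilde{\mathfrak{A}}^E_\kappa(u^+_{\nu-\ell,\ell})\mid \xi_\ell\ne0\}\in(-\infty,\infty]$, and for $0\ne\alpha\in H_{2\nu+1}$ define the spectral number $\sigma(\alpha)=\inf\{\sigma(\xi)\mid[\xi]=\alpha\}\in[-\infty,\infty]$.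 A real number $E>0$ is called a Tate Rabinowitz quantized energy value for the harmonic oscillator if there exist $\kappa>0$, $\nu\in\mathbb{Z}$ and a class $0\ne\alpha\in H_{2\nu+1}(\mathfrak{A}^E_\kappa)$ whose $\mathbb{Z}[\mathbb{Z}]$-equivalence class has a well-defined spectral number in $\mathbb{R}/\hbar\mathbb{Z}$, i.e. $\sigma(\mathfrak{u}^j\alpha)\in\mathbb{R}$ for all $j\in\mathbb{Z}$ and $\sigma(\mathfrak{u}^j\alpha)\equiv\sigma(\alpha)\pmod{\hbar\mathbb{Z}}$ for all $j\in\mathbb{Z}$. *)

theory Defs
  imports
    "HOL-Algebra.Coset"
    "HOL-Library.Extended_Real"
    "HOL-Library.Real_Mod"
begin

section \<open>The Tate Rabinowitz Floer complex of the harmonic oscillator\<close>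

text \<open>\<open>Umin \<nu> l\<close> is \<open>u\<^sup>-\<close> and \<open>Umax \<nu> l\<close> is \<open>u\<^sup>+\<close> at \<open>(\<nu>, l)\<close>.\<close>

datatype generator = Umin int int | Umax int int

fun degree :: "generator \<Rightarrow> int" where
  "degree (Umin \<nu> l) = 2 * (\<nu> + l)"
| "degree (Umax \<nu> l) = 2 * (\<nu> + l) + 1"

text \<open>
  A doubly infinite formal sum is its coefficient function. The generators of degree \<open>2\<nu>\<close> are
  exactly \<open>Umin (\<nu> - l) l\<close> and those of degree \<open>2\<nu> + 1\<close> exactly \<open>Umax (\<nu> - l) l\<close>, with
  \<open>l\<close> ranging over the integers; no finiteness of the support is required.
\<close>

type_synonym chain = "generator \<Rightarrow> int"

definition chain_group :: "int \<Rightarrow> chain monoid" where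
  "chain_group k =
    \<lparr>carrier = {\<xi>. \<forall>g. \<xi> g \<noteq> 0 \<longrightarrow> degree g = k},
     mult = (\<lambda>\<xi> \<eta> g. \<xi> g + \<eta> g),
     one = (\<lambda>g. 0)\<rparr>"

text \<open>
  Since \<open>\<partial> (Umin \<nu> l) = Umax (\<nu> - 1) l + \<nu> * Umax \<nu> (l - 1)\<close>, the generator \<open>Umax a b\<close> occurs
  in the boundary of \<open>Umin (a + 1) b\<close> with coefficient 1, in that of \<open>Umin a (b + 1)\<close> with
  coefficient \<open>a\<close>, and in no other one.
\<close>

fun boundary :: "chain \<Rightarrow> chain" where
  "boundary \<xi> (Umin a b) = 0"
| "boundary \<xi> (Umax a b) = \<xi> (Umin (a + 1) b) + a * \<xi> (Umin a (b + 1))"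

definition single :: "generator \<Rightarrow> chain" where
  "single g = (\<lambda>g'. if g' = g then 1 else 0)"

lemma boundary_single_Umin:
  "boundary (single (Umin \<nu> l)) = (\<lambda>g. single (Umax (\<nu> - 1) l) g + \<nu> * single (Umax \<nu> (l - 1)) g)"
proof
  fix g show "boundary (single (Umin \<nu> l)) g =
      single (Umax (\<nu> - 1) l) g + \<nu> * single (Umax \<nu> (l - 1)) g"
    by (cases g) (auto simp: single_def)
qed

lemma boundary_single_Umax: "boundary (single (Umax \<nu> l)) = (\<lambda>g. 0)"
proof
  fix g show "boundary (single (Umax \<nu> l)) g = 0"
    by (cases g) (auto simp: single_def)
qed

lemma boundary_coeff:
  fixes \<xi> :: chain and x :: "int \<Rightarrow> int"
  assumes "\<And>l. \<xi> (Umin (\<nu> - l) l) = x l"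
  shows "boundary \<xi> (Umax (\<nu> - l - 1) l) = x l + (\<nu> - l - 1) * x (l + 1)"
  using assms[of l] assms[of "l + 1"] by (simp add: algebra_simps)

definition cycles :: "int \<Rightarrow> chain set" where
  "cycles k = kernel (chain_group k) (chain_group (k - 1)) boundary"

definition boundaries :: "int \<Rightarrow> chain set" where
  "boundaries k = boundary ` carrier (chain_group (k + 1))"

definition homology :: "int \<Rightarrow> chain set monoid" where
  "homology k = (chain_group k \<lparr>carrier := cycles k\<rparr>) Mod boundaries k"

definition homology_class :: "int \<Rightarrow> chain \<Rightarrow> chain set" where
  "homology_class k \<xi> = boundaries k #>\<^bsub>chain_group k\<^esub> \<xi>"

lemma comm_group_chain_group: "comm_group (chain_group k)"
proof (rule comm_groupI, goal_cases)
  case (6 \<xi>)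
  show ?case
    by (rule bexI[where x = "\<lambda>g. - \<xi> g"]) (use 6 in \<open>auto simp: chain_group_def\<close>)
next
  case (1 \<xi> \<eta>)
  then show ?case unfolding chain_group_def by simp (metis add_0)
qed (auto simp: chain_group_def)

lemma boundary_hom: "boundary \<in> hom (chain_group k) (chain_group (k - 1))"
proof (rule homI)
  fix \<xi> assume \<xi>: "\<xi> \<in> carrier (chain_group k)"
  have "degree g = k - 1" if "boundary \<xi> g \<noteq> 0" for g
  proof (cases g)
    case (Umin a b)
    with that show ?thesis by simp
  next
    case (Umax a b)
    with that have "\<xi> (Umin (a + 1) b) \<noteq> 0 \<or> \<xi> (Umin a (b + 1)) \<noteq> 0" by auto
    with \<xi> Umax show ?thesis by (auto simp: chain_group_def)
  qed
  then show "boundary \<xi> \<in> carrier (chain_group (k - 1))" by (simp add: chain_group_def)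
next
  fix \<xi> \<eta>
  have "boundary (\<lambda>g. \<xi> g + \<eta> g) g = boundary \<xi> g + boundary \<eta> g" for g
    by (cases g) (auto simp: algebra_simps)
  then show "boundary (\<xi> \<otimes>\<^bsub>chain_group k\<^esub> \<eta>) =
      boundary \<xi> \<otimes>\<^bsub>chain_group (k - 1)\<^esub> boundary \<eta>"
    by (auto simp: chain_group_def)
qed

lemma boundary_boundary: "boundary (boundary \<xi>) = (\<lambda>g. 0)"
proof
  fix g show "boundary (boundary \<xi>) g = 0" by (cases g) auto
qed

lemma subgroup_cycles: "subgroup (cycles k) (chain_group k)"
  unfolding cycles_def
  by (intro group_hom.subgroup_kernel group_hom.intro comm_group.axioms(2)
      comm_group_chain_group group_hom_axioms.intro boundary_hom)

lemma subgroup_boundaries: "subgroup (boundaries k) (chain_group k)"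
proof -
  have "boundary \<in> hom (chain_group (k + 1)) (chain_group k)"
    using boundary_hom[of "k + 1"] by simp
  then interpret group_hom "chain_group (k + 1)" "chain_group k" boundary
    by (intro group_hom.intro comm_group.axioms(2) comm_group_chain_group group_hom_axioms.intro)
  show ?thesis unfolding boundaries_def by (rule img_is_subgroup)
qed

lemma boundaries_subset_cycles: "boundaries k \<subseteq> cycles k"
  using subgroup.subset[OF subgroup_boundaries, of k]
  by (auto simp: boundaries_def cycles_def kernel_def boundary_boundary chain_group_def)

lemma comm_group_homology: "comm_group (homology k)"
proof -
  interpret C: comm_group "chain_group k" by (rule comm_group_chain_group)
  interpret Z: comm_group "chain_group k \<lparr>carrier := cycles k\<rparr>"
    by (intro group.group_comm_groupI C.subgroup_imp_group subgroup_cycles)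
      (simp add: chain_group_def add.commute)
  show ?thesis
    unfolding homology_def
    by (intro Z.abelian_FactGroup C.subgroup_incl subgroup_boundaries subgroup_cycles
        boundaries_subset_cycles)
qed

lemma carrier_homology: "carrier (homology k) = homology_class k ` cycles k"
  by (simp add: homology_def homology_class_def carrier_FactGroup r_coset_def)

lemma one_homology: "\<one>\<^bsub>homology k\<^esub> = boundaries k"
  by (simp add: homology_def)


section \<open>The action of the integers on homology\<close>

fun shift :: "chain \<Rightarrow> chain" where
  "shift \<xi> (Umin \<nu> l) = \<xi> (Umin \<nu> (l - 1))"
| "shift \<xi> (Umax \<nu> l) = \<xi> (Umax \<nu> (l - 1))"

fun unshift :: "chain \<Rightarrow> chain" where
  "unshift \<xi> (Umin \<nu> l) = \<xi> (Umin \<nu> (l + 1))"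
| "unshift \<xi> (Umax \<nu> l) = \<xi> (Umax \<nu> (l + 1))"

lemma shift_single:
  "shift (single (Umin \<nu> l)) = single (Umin \<nu> (l + 1))"
  "shift (single (Umax \<nu> l)) = single (Umax \<nu> (l + 1))"
proof -
  have "shift (single (Umin \<nu> l)) g = single (Umin \<nu> (l + 1)) g" for g
    by (cases g) (auto simp: single_def)
  then show "shift (single (Umin \<nu> l)) = single (Umin \<nu> (l + 1))" by blast
  have "shift (single (Umax \<nu> l)) g = single (Umax \<nu> (l + 1)) g" for g
    by (cases g) (auto simp: single_def)
  then show "shift (single (Umax \<nu> l)) = single (Umax \<nu> (l + 1))" by blast
qed

lemma shift_unshift [simp]: "shift (unshift \<xi>) = \<xi>"
proof
  fix g show "shift (unshift \<xi>) g = \<xi> g" by (cases g) auto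
qed

lemma unshift_shift [simp]: "unshift (shift \<xi>) = \<xi>"
proof
  fix g show "unshift (shift \<xi>) g = \<xi> g" by (cases g) auto
qed

lemma bij_shift: "bij shift"
  by (rule o_bij[where g = unshift]) auto

lemma boundary_shift: "boundary (shift \<xi>) = shift (boundary \<xi>)"
proof
  fix g show "boundary (shift \<xi>) g = shift (boundary \<xi>) g" by (cases g) auto
qed

lemma shift_carrier_iff:
  "shift \<xi> \<in> carrier (chain_group (k + 2)) \<longleftrightarrow> \<xi> \<in> carrier (chain_group k)"
proof -
  have "(\<forall>g. shift \<xi> g \<noteq> 0 \<longrightarrow> degree g = k + 2) \<longleftrightarrow> (\<forall>g. \<xi> g \<noteq> 0 \<longrightarrow> degree g = k)"
  proof (intro iffI allI impI)
    fix g assume *: "\<forall>g. shift \<xi> g \<noteq> 0 \<longrightarrow> degree g = k + 2" and "\<xi> g \<noteq> 0"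
    then show "degree g = k"
    proof (cases g)
      case (Umin \<nu> l)
      with * \<open>\<xi> g \<noteq> 0\<close> show ?thesis by (auto dest: spec[of _ "Umin \<nu> (l + 1)"])
    next
      case (Umax \<nu> l)
      with * \<open>\<xi> g \<noteq> 0\<close> show ?thesis by (auto dest: spec[of _ "Umax \<nu> (l + 1)"])
    qed
  next
    fix g assume *: "\<forall>g. \<xi> g \<noteq> 0 \<longrightarrow> degree g = k" and "shift \<xi> g \<noteq> 0"
    then show "degree g = k + 2" by (cases g) force+
  qed
  then show ?thesis by (simp add: chain_group_def)
qed

lemma shift_image_carrier:
  "shift ` carrier (chain_group k) = carrier (chain_group (k + 2))"
proof (intro subset_antisym subsetI)
  fix \<xi> assume "\<xi> \<in> carrier (chain_group (k + 2))"
  then have "unshift \<xi> \<in> carrier (chain_group k)"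
    using shift_carrier_iff[of "unshift \<xi>" k] by simp
  then have "shift (unshift \<xi>) \<in> shift ` carrier (chain_group k)" by (rule imageI)
  then show "\<xi> \<in> shift ` carrier (chain_group k)" by simp
qed (auto simp: shift_carrier_iff)

text \<open>
  Homology classes are cosets and \<open>shift\<close> is bijective on chains, so the induced map on homology
  is the elementwise image; see \<open>u_map_class\<close> below.
\<close>

definition u_map :: "chain set \<Rightarrow> chain set" where
  "u_map \<alpha> = shift ` \<alpha>"

lemma shift_image_boundaries: "shift ` boundaries k = boundaries (k + 2)"
proof -
  have "shift ` boundaries k = boundary ` shift ` carrier (chain_group (k + 1))"
    by (simp add: boundaries_def image_image boundary_shift)
  also have "\<dots> = boundaries (k + 2)"
    by (simp only: boundaries_def shift_image_carrier) (simp add: add_ac)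
  finally show ?thesis .
qed

lemma u_map_class: "u_map (homology_class k \<xi>) = homology_class (k + 2) (shift \<xi>)"
proof -
  have *: "shift (\<lambda>g. \<eta> g + \<xi> g) = (\<lambda>g. shift \<eta> g + shift \<xi> g)" for \<eta>
  proof
    fix g show "shift (\<lambda>g. \<eta> g + \<xi> g) g = shift \<eta> g + shift \<xi> g" by (cases g) auto
  qed
  have "u_map (homology_class k \<xi>) = (\<Union>\<eta>\<in>shift ` boundaries k. {\<lambda>g. \<eta> g + shift \<xi> g})"
    by (simp add: u_map_def homology_class_def r_coset_def chain_group_def image_UN *)
  then show ?thesis
    by (simp add: shift_image_boundaries homology_class_def r_coset_def chain_group_def)
qed

lemma shift_image_cycles: "shift ` cycles k = cycles (k + 2)"
proof -
  have zero: "shift \<xi> = (\<lambda>g. 0) \<longleftrightarrow> \<xi> = (\<lambda>g. 0)" for \<xi>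
  proof
    assume "shift \<xi> = (\<lambda>g. 0)"
    then have "unshift (shift \<xi>) g = unshift (\<lambda>g. 0) g" for g by simp
    then have "\<xi> g = 0" for g by (cases g) auto
    then show "\<xi> = (\<lambda>g. 0)" by blast
  next
    assume "\<xi> = (\<lambda>g. 0)"
    then have "shift \<xi> g = 0" for g by (cases g) auto
    then show "shift \<xi> = (\<lambda>g. 0)" by blast
  qed
  have cyc: "\<xi> \<in> cycles m \<longleftrightarrow> \<xi> \<in> carrier (chain_group m) \<and> boundary \<xi> = (\<lambda>g. 0)" for \<xi> m
    by (simp add: cycles_def kernel_def) (simp add: chain_group_def)
  have iff: "shift \<xi> \<in> cycles (k + 2) \<longleftrightarrow> \<xi> \<in> cycles k" for \<xi>
    by (simp add: cyc shift_carrier_iff boundary_shift zero)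
  show ?thesis
  proof (intro subset_antisym subsetI)
    fix \<xi> assume "\<xi> \<in> cycles (k + 2)"
    then have "shift (unshift \<xi>) \<in> shift ` cycles k"
      using iff[of "unshift \<xi>"] by (intro imageI) simp
    then show "\<xi> \<in> shift ` cycles k" by simp
  qed (auto simp: iff)
qed

lemma bij_betw_u_map: "bij_betw u_map (carrier (homology k)) (carrier (homology (k + 2)))"
  unfolding bij_betw_def
proof
  show "inj_on u_map (carrier (homology k))"
    using bij_is_inj[OF bij_shift] by (auto simp: inj_on_def u_map_def inj_image_eq_iff)
  show "u_map ` carrier (homology k) = carrier (homology (k + 2))"
    by (simp add: carrier_homology image_image u_map_class flip: shift_image_cycles)
qed

lemma bij_u_map: "bij u_map"
  by (rule o_bij[where g = "(`) unshift"]) (simp_all add: fun_eq_iff u_map_def image_image)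

text \<open>
  Because of \<open>bij_u_map\<close>, the total inverse used for negative exponents restricts to the inverses
  of the isomorphisms of \<open>bij_betw_u_map\<close>.
\<close>

definition u_pow :: "int \<Rightarrow> chain set \<Rightarrow> chain set" where
  "u_pow j = (if 0 \<le> j then u_map ^^ nat j else inv_into UNIV u_map ^^ nat (- j))"


section \<open>Spectral numbers and quantized energy values\<close>

text \<open>The action of \<open>Umin \<nu> l\<close> and \<open>Umax \<nu> l\<close>:\<close>

definition action :: "real \<Rightarrow> real \<Rightarrow> int \<Rightarrow> int \<Rightarrow> real" where
  "action E \<kappa> \<nu> l = E * \<nu> + \<kappa> * l"

definition shifted_action :: "real \<Rightarrow> real \<Rightarrow> real \<Rightarrow> int \<Rightarrow> int \<Rightarrow> real" where
  "shifted_action hbar E \<kappa> \<nu> l = action E \<kappa> \<nu> l + \<nu> * hbar / 2"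

text \<open>
  Only meaningful for nonzero chains of odd degree. Every representative of a nonzero class is
  nonzero, so the value \<open>-\<infinity>\<close> at the zero chain plays no role for such a class.
\<close>

definition chain_spectral :: "real \<Rightarrow> real \<Rightarrow> real \<Rightarrow> chain \<Rightarrow> ereal" where
  "chain_spectral hbar E \<kappa> \<xi> =
    Sup {ereal (shifted_action hbar E \<kappa> \<nu> l) | \<nu> l. \<xi> (Umax \<nu> l) \<noteq> 0}"

text \<open>The representatives of a class are the elements of the coset.\<close>

definition spectral_number :: "real \<Rightarrow> real \<Rightarrow> real \<Rightarrow> chain set \<Rightarrow> ereal" where
  "spectral_number hbar E \<kappa> \<alpha> = (INF \<xi>\<in>\<alpha>. chain_spectral hbar E \<kappa> \<xi>)"

definition well_defined_spectral_number :: "real \<Rightarrow> real \<Rightarrow> real \<Rightarrow> chain set \<Rightarrow> bool" where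
  "well_defined_spectral_number hbar E \<kappa> \<alpha> \<longleftrightarrow>
    (\<forall>j. \<bar>spectral_number hbar E \<kappa> (u_pow j \<alpha>)\<bar> \<noteq> \<infinity>) \<and>
    (\<forall>j. [real_of_ereal (spectral_number hbar E \<kappa> (u_pow j \<alpha>)) =
          real_of_ereal (spectral_number hbar E \<kappa> \<alpha>)] (rmod hbar))"

text \<open>
  The chain groups and the boundary operator do not depend on \<open>E\<close> and \<open>\<kappa>\<close>; these enter only
  through the action.
\<close>

definition quantized_energy_value :: "real \<Rightarrow> real \<Rightarrow> bool" where
  "quantized_energy_value hbar E \<longleftrightarrow>
    E > 0 \<and>
    (\<exists>\<kappa>>0. \<exists>\<nu>. \<exists>\<alpha>\<in>carrier (homology (2 * \<nu> + 1)).
      \<alpha> \<noteq> \<one>\<^bsub>homology (2 * \<nu> + 1)\<^esub> \<and> well_defined_spectral_number hbar E \<kappa> \<alpha>)"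

end

(* A cycle z of odd degree is a boundary iff z_a = X_{a+1} + a X_a is solvable over the integers,
   where z_a is the coefficient of Umax a (\<nu> - a). The recursion can be solved upwards from any
   starting index, so a chain vanishing for all small a is a boundary, and every class can be
   represented by chains supported on arbitrarily small a. The shifted action at a is
   a (E - \<kappa> + hbar/2) + \<kappa> \<nu>. Hence the spectral number of a nonzero class is -\<infinity> or +\<infinity> when the slope
   is positive or negative, and \<kappa> \<nu> when the slope vanishes. As \<open>u\<close> raises \<nu> by 1, it is well
   defined modulo hbar iff \<kappa> = E + hbar/2 is a multiple of hbar. Finally the homology is nonzero:
   the chain with z_a = 1 for all a is not a boundary. *)

theory Submission
  imports Defs
begin

section \<open>Cycles and boundaries in odd degree\<close>

lemma chain_group_simps [simp]:
  "\<xi> \<in> carrier (chain_group k) \<longleftrightarrow> (\<forall>g. \<xi> g \<noteq> 0 \<longrightarrow> degree g = k)"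
  "\<xi> \<otimes>\<^bsub>chain_group k\<^esub> \<eta> = (\<lambda>g. \<xi> g + \<eta> g)"
  "\<one>\<^bsub>chain_group k\<^esub> = (\<lambda>g. 0)"
  by (simp_all add: chain_group_def)

text \<open>By parity a chain of odd degree has no \<open>Umin\<close> coefficients, and these are
  all that \<open>boundary\<close> reads.\<close>

lemma cycles_odd: "cycles (2 * \<nu> + 1) = carrier (chain_group (2 * \<nu> + 1))"
proof -
  have "boundary \<xi> g = 0" if "\<xi> \<in> carrier (chain_group (2 * \<nu> + 1))" for \<xi> g
  proof (cases g)
    case (Umax a b)
    have "2 * (c + d) \<noteq> 2 * \<nu> + 1" for c d :: int by presburger
    then have "\<xi> (Umin c d) = 0" for c d
      using that by (metis chain_group_simps(1) degree.simps(1))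
    then show ?thesis by (simp add: Umax)
  qed simp
  then show ?thesis by (auto simp: cycles_def kernel_def)
qed

text \<open>The equation \<open>X (a + 1) = z a - a * X a\<close> is solved upwards from \<open>X m = 0\<close>.\<close>

lemma boundaries_if_bounded_below:
  assumes \<zeta>: "\<zeta> \<in> carrier (chain_group (2 * \<nu> + 1))"
    and low: "\<And>a b. a < m \<Longrightarrow> \<zeta> (Umax a b) = 0"
  shows "\<zeta> \<in> boundaries (2 * \<nu> + 1)"
proof -
  define Y where "Y = rec_nat (0::int)
    (\<lambda>n y. \<zeta> (Umax (m + int n) (\<nu> - (m + int n))) - (m + int n) * y)"
  have Y: "Y 0 = 0" "\<And>n. Y (Suc n) =
      \<zeta> (Umax (m + int n) (\<nu> - (m + int n))) - (m + int n) * Y n"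
    by (simp_all add: Y_def)
  \<comment> \<open>Since \<open>nat\<close> truncates, \<open>X\<close> vanishes at and below
    \<open>m\<close>. For \<open>a < m\<close> both terms of the recursion are therefore zero,
    matching \<open>low\<close>.\<close>
  define X where "X a = Y (nat (a - m))" for a
  have X: "X (a + 1) + a * X a = \<zeta> (Umax a (\<nu> - a))" for a
  proof (cases "a < m")
    case True
    then show ?thesis by (simp add: X_def Y low)
  next
    case False
    then obtain n where a: "a = m + int n"
      by (metis zle_iff_zadd linorder_not_less)
    have "nat (a + 1 - m) = Suc n" "nat (a - m) = n" by (simp_all add: a)
    then show ?thesis unfolding X_def by (simp only: Y) (simp add: a)
  qed
  define \<xi> where "\<xi> g = (case g of Umin c b \<Rightarrow> if c + b = \<nu> + 1 then X c else 0 | Umax c b \<Rightarrow> 0)"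
    for g
  have "\<xi> \<in> carrier (chain_group (2 * \<nu> + 1 + 1))"
    by (auto simp: \<xi>_def split: generator.splits if_splits)
  moreover have "boundary \<xi> g = \<zeta> g" for g
  proof (cases g)
    case (Umin a b)
    have "2 * (a + b) \<noteq> 2 * \<nu> + 1" by presburger
    then have "\<zeta> (Umin a b) = 0"
      using \<zeta> by auto
    then show ?thesis by (simp add: Umin)
  next
    case (Umax a b)
    show ?thesis
    proof (cases "a + b = \<nu>")
      case True
      then have "b = \<nu> - a" by simp
      then show ?thesis by (simp add: Umax \<xi>_def X)
    next
      case False
      then have "\<zeta> (Umax a b) = 0"
        using \<zeta> by auto
      then show ?thesis using False by (simp add: Umax \<xi>_def)
    qed
  qed
  ultimately show ?thesis
    unfolding boundaries_def by (metis ext image_eqI)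
qed

text \<open>Read downwards, the recursion divides by ever larger integers. Integral coefficients
  then stay bounded and eventually vanish, but two consecutive zeros contradict the inhomogeneous
  term 1.\<close>

lemma all_ones_not_boundary:
  "(\<lambda>g. case g of Umin a b \<Rightarrow> 0 | Umax a b \<Rightarrow> if a + b = \<nu> then 1 else 0) \<notin> boundaries k"
proof
  assume "(\<lambda>g. case g of Umin a b \<Rightarrow> 0 | Umax a b \<Rightarrow> if a + b = \<nu> then 1 else 0) \<in> boundaries k"
  then obtain \<xi> where \<xi>:
    "boundary \<xi> = (\<lambda>g. case g of Umin a b \<Rightarrow> 0 | Umax a b \<Rightarrow> if a + b = \<nu> then 1 else 0)"
    unfolding boundaries_def by force
  define Y where "Y n = \<xi> (Umin (- int n) (\<nu> + int n + 1))" for n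
  \<comment> \<open>At the index \<open>a = - int n - 1\<close> the factor \<open>a\<close> of the
    boundary formula becomes the divisor \<open>int n + 1\<close>.\<close>
  have Y: "(int n + 1) * Y (Suc n) = Y n - 1" for n
    using fun_cong[OF \<xi>, of "Umax (- int n - 1) (\<nu> + int n + 1)"]
    by (simp add: Y_def algebra_simps minus_diff_commute)
  have bound: "\<bar>Y n\<bar> \<le> \<bar>Y 0\<bar> + 1" for n
  proof (induction n)
    case (Suc n)
    show ?case
    \<comment> \<open>For \<open>n = 0\<close> nothing is divided, whence the extra 1 in the bound.
      Afterwards the divisor is at least 2, and halving absorbs the new 1.\<close>
    proof (cases n)
      case 0
      then show ?thesis using Y[of 0] by simp
    next
      case (Suc k)
      have "2 * \<bar>Y (Suc n)\<bar> \<le> (int n + 1) * \<bar>Y (Suc n)\<bar>"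
        by (intro mult_right_mono) (simp_all add: Suc)
      also have "\<dots> = \<bar>Y n - 1\<bar>"
        by (simp flip: Y add: abs_mult)
      finally show ?thesis using Suc.IH by linarith
    qed
  qed simp
  have zero: "Y (Suc n) = 0" if "int n > \<bar>Y 0\<bar> + 1" for n
  proof (rule ccontr)
    assume "Y (Suc n) \<noteq> 0"
    \<comment> \<open>Integrality enters here: a nonzero integer has absolute value at least
      1.\<close>
    then have "int n + 1 \<le> (int n + 1) * \<bar>Y (Suc n)\<bar>" by simp
    also have "\<dots> = \<bar>Y n - 1\<bar>"
      by (simp flip: Y add: abs_mult)
    finally show False using bound[of n] that by linarith
  qed
  define n where "n = nat (\<bar>Y 0\<bar> + 2)"
  have "Y (Suc n) = 0" "Y (Suc (Suc n)) = 0"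
    by (auto intro!: zero simp: n_def)
  with Y[of "Suc n"] show False by simp
qed

section \<open>Homology classes as cosets, and nonzero classes under \<open>u_map\<close>\<close>

lemma mem_class_iff: "\<zeta> \<in> homology_class k \<xi> \<longleftrightarrow> (\<lambda>g. \<zeta> g - \<xi> g) \<in> boundaries k"
proof
  assume "(\<lambda>g. \<zeta> g - \<xi> g) \<in> boundaries k"
  then have "(\<lambda>g. (\<zeta> g - \<xi> g) + \<xi> g) \<in> homology_class k \<xi>"
    unfolding homology_class_def r_coset_def by force
  then show "\<zeta> \<in> homology_class k \<xi>" by simp
qed (auto simp: homology_class_def r_coset_def)

lemma diff_boundaries:
  assumes "\<xi> \<in> boundaries k" "\<eta> \<in> boundaries k"
  shows "(\<lambda>g. \<xi> g - \<eta> g) \<in> boundaries k"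
proof -
  obtain x y where *: "x \<in> carrier (chain_group (k + 1))" "\<xi> = boundary x"
     "y \<in> carrier (chain_group (k + 1))" "\<eta> = boundary y"
    using assms by (auto simp: boundaries_def)
  have "boundary (\<lambda>g. x g - y g) g = boundary x g - boundary y g" for g
    by (cases g) (auto simp: algebra_simps)
  moreover have "(\<lambda>g. x g - y g) \<in> carrier (chain_group (k + 1))"
    using * by (simp add: chain_group_simps(1)) (metis diff_0_right)
  ultimately show ?thesis
    unfolding boundaries_def using * by (intro image_eqI[where x = "\<lambda>g. x g - y g"]) auto
qed

lemma
  assumes \<alpha>: "\<alpha> \<in> carrier (homology k)" and \<zeta>: "\<zeta> \<in> \<alpha>"
  shows homology_chain: "\<zeta> \<in> carrier (chain_group k)"
    and homology_not_boundary: "\<alpha> \<noteq> \<one>\<^bsub>homology k\<^esub> \<Longrightarrow> \<zeta> \<notin> boundaries k"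
    and homology_diff: "\<eta> \<in> boundaries k \<Longrightarrow> (\<lambda>g. \<zeta> g - \<eta> g) \<in> \<alpha>"
proof -
  obtain \<xi> where \<xi>: "\<xi> \<in> cycles k" "\<alpha> = homology_class k \<xi>"
    using \<alpha> by (auto simp: carrier_homology)
  have d: "(\<lambda>g. \<zeta> g - \<xi> g) \<in> boundaries k" using \<zeta> \<xi> mem_class_iff by simp
  then have c: "(\<lambda>g. \<zeta> g - \<xi> g) \<in> carrier (chain_group k)"
    using subgroup.subset[OF subgroup_boundaries] by blast
  have "\<xi> \<in> carrier (chain_group k)" using \<xi> subgroup.subset[OF subgroup_cycles] by blast
  then show "\<zeta> \<in> carrier (chain_group k)"
    using c by (simp add: chain_group_simps(1)) (metis diff_0_right)
  show "\<zeta> \<notin> boundaries k" if "\<alpha> \<noteq> \<one>\<^bsub>homology k\<^esub>"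
  proof
    assume "\<zeta> \<in> boundaries k"
    \<comment> \<open>\<open>\<xi>\<close> is recovered as
      \<open>\<zeta> - (\<zeta> - \<xi>)\<close>, so it is a boundary too and its coset is the zero
      class.\<close>
    from diff_boundaries[OF this d] have x: "\<xi> \<in> boundaries k" by simp
    interpret group "chain_group k" by (rule comm_group.axioms(2)[OF comm_group_chain_group])
    from x have "homology_class k \<xi> = boundaries k"
      unfolding homology_class_def by (intro coset_join2 subgroup_boundaries)
        (use subgroup.subset[OF subgroup_boundaries] in blast)+
    with that \<xi> show False by (simp add: one_homology)
  qed
  show "(\<lambda>g. \<zeta> g - \<eta> g) \<in> \<alpha>" if "\<eta> \<in> boundaries k"
    using diff_boundaries[OF d that] \<xi> by (simp add: mem_class_iff algebra_simps)
qed

lemma homology_nonempty: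
  assumes "\<alpha> \<in> carrier (homology k)"
  shows "\<alpha> \<noteq> {}"
proof -
  obtain \<xi> where "\<alpha> = homology_class k \<xi>" using assms by (auto simp: carrier_homology)
  then have "\<xi> \<in> \<alpha>"
    using subgroup.one_closed[OF subgroup_boundaries, of k] by (simp add: mem_class_iff)
  then show ?thesis by blast
qed

text \<open>Injectivity of \<open>u_map\<close> gives both directions. The forward one lets nonzero
  classes descend along the inverse, as negative exponents require.\<close>

lemma u_map_nonzero_class:
  "u_map \<alpha> \<in> carrier (homology (k + 2)) - {\<one>\<^bsub>homology (k + 2)\<^esub>} \<longleftrightarrow>
    \<alpha> \<in> carrier (homology k) - {\<one>\<^bsub>homology k\<^esub>}"
proof -
  have one: "u_map \<one>\<^bsub>homology k\<^esub> = \<one>\<^bsub>homology (k + 2)\<^esub>"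
    by (simp add: one_homology u_map_def shift_image_boundaries)
  have "carrier (homology (k + 2)) = u_map ` carrier (homology k)"
    using bij_betw_u_map[of k] by (simp add: bij_betw_def)
  then show ?thesis
    using bij_is_inj[OF bij_u_map] by (simp flip: one add: inj_image_mem_iff inj_eq)
qed

lemma u_pow_nonzero_class:
  assumes "\<alpha> \<in> carrier (homology k) - {\<one>\<^bsub>homology k\<^esub>}"
  shows "u_pow j \<alpha> \<in> carrier (homology (k + 2 * j)) - {\<one>\<^bsub>homology (k + 2 * j)\<^esub>}"
proof -
  have pos: "(u_map ^^ n) \<alpha> \<in> carrier (homology (k + 2 * int n)) - {\<one>\<^bsub>homology (k + 2 * int n)\<^esub>}"
    for n
  proof (induction n)
    case (Suc n)
    have "k + 2 * int (Suc n) = (k + 2 * int n) + 2" by simp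
    with Suc show ?case by (simp only: u_map_nonzero_class funpow.simps comp_apply)
  qed (use assms in simp)
  have neg: "(inv_into UNIV u_map ^^ n) \<alpha> \<in>
      carrier (homology (k - 2 * int n)) -
      {\<one>\<^bsub>homology (k - 2 * int n)\<^esub>}" for n
  proof (induction n)
    case (Suc n)
    have "u_map ((inv_into UNIV u_map ^^ Suc n) \<alpha>) = (inv_into UNIV u_map ^^ n) \<alpha>"
      by (simp add: surj_f_inv_f[OF bij_is_surj[OF bij_u_map]])
    moreover have "k - 2 * int n = (k - 2 * int (Suc n)) + 2" by simp
    ultimately show ?case using Suc u_map_nonzero_class by metis
  qed (use assms in simp)
  show ?thesis
    using pos[of "nat j"] neg[of "nat (- j)"] by (cases "0 \<le> j") (simp_all add: u_pow_def)
qed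

section \<open>Spectral numbers of nonzero classes of odd degree\<close>

lemma shifted_action_slope:
  "shifted_action hbar E \<kappa> a (\<nu> - a) = real_of_int a * (E - \<kappa> + hbar / 2) + \<kappa> * \<nu>"
  by (simp add: shifted_action_def action_def algebra_simps)

text \<open>The degree forces \<open>b = \<nu> - a\<close>, so the support is indexed by
  \<open>a\<close> alone.\<close>

lemma chain_spectral_odd:
  assumes "\<zeta> \<in> carrier (chain_group (2 * \<nu> + 1))"
  shows "chain_spectral hbar E \<kappa> \<zeta> =
    (SUP a\<in>{a. \<zeta> (Umax a (\<nu> - a)) \<noteq> 0}. ereal (real_of_int a * (E - \<kappa> + hbar / 2) + \<kappa> * \<nu>))"
proof -
  have "b = \<nu> - a" if "\<zeta> (Umax a b) \<noteq> 0" for a b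
    using assms that by (auto dest!: spec[of _ "Umax a b"])
  then have "{ereal (shifted_action hbar E \<kappa> a b) | a b. \<zeta> (Umax a b) \<noteq> 0} =
    (\<lambda>a. ereal (shifted_action hbar E \<kappa> a (\<nu> - a))) ` {a. \<zeta> (Umax a (\<nu> - a)) \<noteq> 0}"
    by blast
  then show ?thesis unfolding chain_spectral_def shifted_action_slope by simp
qed

context
  fixes \<nu> :: int and \<alpha> :: "chain set"
  assumes \<alpha>: "\<alpha> \<in> carrier (homology (2 * \<nu> + 1)) - {\<one>\<^bsub>homology (2 * \<nu> + 1)\<^esub>}"
begin

text \<open>Otherwise the representative would be bounded below, hence a boundary, and the class
  would be zero.\<close>

lemma representative_unbounded_below:
  assumes "\<zeta> \<in> \<alpha>"
  shows "\<exists>a<m. \<zeta> (Umax a (\<nu> - a)) \<noteq> 0"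
proof (rule ccontr)
  assume *: "\<not> ?thesis"
  have \<zeta>: "\<zeta> \<in> carrier (chain_group (2 * \<nu> + 1))" using homology_chain assms \<alpha> by blast
  have "\<zeta> (Umax a b) = 0" if "a < m" for a b
  proof (rule ccontr)
    assume "\<zeta> (Umax a b) \<noteq> 0"
    moreover from this \<zeta> have "b = \<nu> - a" by (auto dest!: spec[of _ "Umax a b"])
    ultimately show False using * that by blast
  qed
  from boundaries_if_bounded_below[OF \<zeta> this] show False
    using homology_not_boundary assms \<alpha> by blast
qed

lemma representative_below:
  obtains \<zeta> where "\<zeta> \<in> \<alpha>" "\<And>a b. a \<ge> m \<Longrightarrow> \<zeta> (Umax a b) = 0"
proof -
  obtain \<xi> where \<xi>: "\<xi> \<in> \<alpha>" using homology_nonempty \<alpha> by blast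
  \<comment> \<open>\<open>\<eta>\<close> is the part of \<open>\<xi>\<close> at indices
    \<open>a \<ge> m\<close>. Being bounded below it is a boundary, so subtracting it stays in the
    class.\<close>
  define \<eta> where "\<eta> g = (case g of Umin a b \<Rightarrow> 0 | Umax a b \<Rightarrow> if a < m then 0 else \<xi> g)" for g
  have "\<xi> \<in> carrier (chain_group (2 * \<nu> + 1))" using homology_chain \<xi> \<alpha> by blast
  then have "\<eta> \<in> carrier (chain_group (2 * \<nu> + 1))"
    by (auto simp: \<eta>_def split: generator.splits if_splits)
  then have "\<eta> \<in> boundaries (2 * \<nu> + 1)"
    by (rule boundaries_if_bounded_below[where m = m]) (simp add: \<eta>_def)
  then have "(\<lambda>g. \<xi> g - \<eta> g) \<in> \<alpha>" using homology_diff \<xi> \<alpha> by blast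
  then show thesis by (rule that) (simp add: \<eta>_def)
qed

lemma spectral_number_zero_slope:
  assumes "E - \<kappa> + hbar / 2 = 0"
  shows "spectral_number hbar E \<kappa> \<alpha> = ereal (\<kappa> * \<nu>)"
proof -
  have "chain_spectral hbar E \<kappa> \<zeta> = ereal (\<kappa> * \<nu>)" if "\<zeta> \<in> \<alpha>" for \<zeta>
  proof -
    have odd: "\<zeta> \<in> carrier (chain_group (2 * \<nu> + 1))" using homology_chain that \<alpha> by blast
    \<comment> \<open>The action is constant on the support, so only an empty support, with supremum
      \<open>-\<infinity>\<close>, has to be excluded.\<close>
    have "{a. \<zeta> (Umax a (\<nu> - a)) \<noteq> 0} \<noteq> {}"
      using representative_unbounded_below[OF that] by blast
    then show ?thesis by (simp add: chain_spectral_odd[OF odd] assms)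
  qed
  moreover have "\<alpha> \<noteq> {}" using homology_nonempty \<alpha> by blast
  ultimately show ?thesis by (simp add: spectral_number_def cong: INF_cong)
qed

lemma spectral_number_pos_slope:
  assumes "E - \<kappa> + hbar / 2 > 0" (is "?s > 0")
  shows "spectral_number hbar E \<kappa> \<alpha> = -\<infinity>"
proof (rule ereal_bot)
  fix B :: real
  \<comment> \<open>With positive slope, all indices up to \<open>m\<close> have action at most
    \<open>B\<close>.\<close>
  obtain m :: int where "real_of_int m < (B - \<kappa> * \<nu>) / ?s" using ex_of_int_less by blast
  then have m: "real_of_int m * ?s + \<kappa> * \<nu> \<le> B" using assms by (simp add: pos_less_divide_eq)
  obtain \<zeta> where \<zeta>: "\<zeta> \<in> \<alpha>" "\<And>a b. a \<ge> m \<Longrightarrow> \<zeta> (Umax a b) = 0"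
    using representative_below by blast
  then have odd: "\<zeta> \<in> carrier (chain_group (2 * \<nu> + 1))" using homology_chain \<alpha> by blast
  have "chain_spectral hbar E \<kappa> \<zeta> \<le> ereal B"
    unfolding chain_spectral_odd[OF odd]
  proof (intro SUP_least, simp only: ereal_less_eq mem_Collect_eq)
    fix a assume "\<zeta> (Umax a (\<nu> - a)) \<noteq> 0"
    then have "a \<le> m" using \<zeta>(2)[of a] by force
    then have "real_of_int a * ?s \<le> real_of_int m * ?s" using assms by (intro mult_right_mono) auto
    then show "real_of_int a * ?s + \<kappa> * \<nu> \<le> B" using m by linarith
  qed
  with \<zeta>(1) show "spectral_number hbar E \<kappa> \<alpha> \<le> ereal B"
    unfolding spectral_number_def by (meson INF_lower order_trans)
qed

lemma spectral_number_neg_slope: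
  assumes "E - \<kappa> + hbar / 2 < 0" (is "?s < 0")
  shows "spectral_number hbar E \<kappa> \<alpha> = \<infinity>"
proof (rule ereal_top)
  fix B :: real
  \<comment> \<open>Multiplying by the negative slope reverses the inequality: indices below
    \<open>m\<close> have action at least \<open>B\<close>, and every representative has one in its
    support.\<close>
  obtain m :: int where "real_of_int m < (B - \<kappa> * \<nu>) / ?s" using ex_of_int_less by blast
  then have m: "real_of_int m * ?s + \<kappa> * \<nu> \<ge> B" using assms by (simp add: neg_less_divide_eq)
  show "ereal B \<le> spectral_number hbar E \<kappa> \<alpha>"
    unfolding spectral_number_def
  proof (rule INF_greatest)
    fix \<zeta> assume \<zeta>: "\<zeta> \<in> \<alpha>"
    then have odd: "\<zeta> \<in> carrier (chain_group (2 * \<nu> + 1))" using homology_chain \<alpha> by blast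
    obtain a where a: "a < m" "\<zeta> (Umax a (\<nu> - a)) \<noteq> 0"
      using representative_unbounded_below[OF \<zeta>] by blast
    have "real_of_int m * ?s \<le> real_of_int a * ?s"
      using assms a by (intro mult_right_mono_neg) auto
    then have "B \<le> real_of_int a * ?s + \<kappa> * \<nu>" using m by linarith
    with a show "ereal B \<le> chain_spectral hbar E \<kappa> \<zeta>"
      unfolding chain_spectral_odd[OF odd] by (intro SUP_upper2[of a]) auto
  qed
qed

lemma well_defined_spectral_number_iff:
  "well_defined_spectral_number hbar E \<kappa> \<alpha> \<longleftrightarrow>
    E - \<kappa> + hbar / 2 = 0 \<and> (\<exists>n::int. \<kappa> = real_of_int n * hbar)"
  (is "?W \<longleftrightarrow> ?s = 0 \<and> _")
proof -
  have pow: "u_pow j \<alpha> \<in> carrier (homology (2 * (\<nu> + j) + 1)) - {\<one>\<^bsub>homology (2 * (\<nu> + j) + 1)\<^esub>}"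
    for j
    using u_pow_nonzero_class[OF \<alpha>, of j] by (simp add: algebra_simps)
  show ?thesis
  proof (cases "?s = 0")
    case True
    \<comment> \<open>The zero-slope formula for an arbitrary nonzero class is applied to
      \<open>u_pow j \<alpha>\<close>, with \<open>\<nu> + j\<close> in place of
      \<open>\<nu>\<close>.\<close>
    have sn: "spectral_number hbar E \<kappa> (u_pow j \<alpha>) = ereal (\<kappa> * (\<nu> + j))" for j
      using Submission.spectral_number_zero_slope[OF pow True, of j] by simp
    have "?W \<longleftrightarrow> (\<forall>j::int. [\<kappa> * (\<nu> + j) = \<kappa> * \<nu>] (rmod hbar))"
      by (simp add: well_defined_spectral_number_def sn spectral_number_zero_slope[OF True])
    also have "\<dots> \<longleftrightarrow> (\<exists>n::int. \<kappa> = real_of_int n * hbar)"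
    proof
      assume "\<forall>j::int. [\<kappa> * (\<nu> + j) = \<kappa> * \<nu>] (rmod hbar)"
      \<comment> \<open>The case \<open>j = 1\<close> suffices, as consecutive values differ by
        \<open>\<kappa>\<close>.\<close>
      then have "[\<kappa> * (\<nu> + (1::int)) = \<kappa> * \<nu>] (rmod hbar)" by blast
      then obtain n where "\<kappa> * \<nu> = \<kappa> * (\<nu> + (1::int)) + of_int n * hbar"
        by (auto simp: rcong_altdef)
      then have "\<kappa> = real_of_int (- n) * hbar" by (simp add: algebra_simps)
      then show "\<exists>n::int. \<kappa> = real_of_int n * hbar" by blast
    next
      assume "\<exists>n::int. \<kappa> = real_of_int n * hbar"
      then obtain n :: int where "\<kappa> = n * hbar" by blast
      \<comment> \<open>The sign is negative because the congruence unfolds to the right value as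
        the left one plus a multiple of \<open>hbar\<close>.\<close>
      then have "\<kappa> * \<nu> = \<kappa> * (\<nu> + j) + of_int (- (n * j)) * hbar" for j :: int
        by (simp add: algebra_simps)
      then show "\<forall>j::int. [\<kappa> * (\<nu> + j) = \<kappa> * \<nu>] (rmod hbar)"
        unfolding rcong_altdef by blast
    qed
    finally show ?thesis using True by simp
  next
    case False
    \<comment> \<open>Finiteness already fails at exponent 0.\<close>
    have "u_pow 0 \<alpha> = \<alpha>" by (simp add: u_pow_def)
    moreover have "\<bar>spectral_number hbar E \<kappa> \<alpha>\<bar> = \<infinity>"
      using False spectral_number_pos_slope spectral_number_neg_slope
      by (cases "?s > 0") (auto simp: not_less)
    ultimately have "\<not> ?W" unfolding well_defined_spectral_number_def by metis
    with False show ?thesis by blast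
  qed
qed

end

section \<open>Existence of a nonzero class, and the quantized values\<close>

lemma homology_odd_nontrivial: "carrier (homology (2 * \<nu> + 1)) - {\<one>\<^bsub>homology (2 * \<nu> + 1)\<^esub>} \<noteq> {}"
proof -
  define \<zeta> :: chain where
    "\<zeta> g = (case g of Umin a b \<Rightarrow> 0 | Umax a b \<Rightarrow> if a + b = \<nu> then 1 else 0)" for g
  have "\<zeta> \<in> cycles (2 * \<nu> + 1)"
    \<comment> \<open>By \<open>cycles_odd\<close> only the degree of the support has to be
      checked.\<close>
    by (auto simp: cycles_odd \<zeta>_def split: generator.splits if_splits)
  then have "homology_class (2 * \<nu> + 1) \<zeta> \<in> carrier (homology (2 * \<nu> + 1))"
    by (simp add: carrier_homology)
  moreover have "\<zeta> \<in> homology_class (2 * \<nu> + 1) \<zeta>"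
    using subgroup.one_closed[OF subgroup_boundaries, of "2 * \<nu> + 1"] by (simp add: mem_class_iff)
  moreover have "\<zeta> \<notin> boundaries (2 * \<nu> + 1)"
    using all_ones_not_boundary[of \<nu>] unfolding \<zeta>_def by blast
  ultimately show ?thesis unfolding one_homology by blast
qed

theorem theoremA:
  fixes hbar :: real
  assumes "hbar > 0"
  shows "{E. quantized_energy_value hbar E} = {(real n - 1 / 2) * hbar | n :: nat. n \<ge> 1}"
proof (intro subset_antisym subsetI)
  fix E assume "E \<in> {E. quantized_energy_value hbar E}"
  then obtain \<kappa> \<nu> \<alpha> where "\<kappa> > 0"
    "\<alpha> \<in> carrier (homology (2 * \<nu> + 1)) - {\<one>\<^bsub>homology (2 * \<nu> + 1)\<^esub>}"
    "well_defined_spectral_number hbar E \<kappa> \<alpha>"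
    unfolding quantized_energy_value_def by blast
  then obtain n :: int where n: "E - \<kappa> + hbar / 2 = 0" "\<kappa> = real_of_int n * hbar" "\<kappa> > 0"
    using well_defined_spectral_number_iff by blast
  \<comment> \<open>Positivity of \<open>\<kappa>\<close> and \<open>hbar\<close> is what makes the
    values start at \<open>hbar / 2\<close>.\<close>
  then have "n > 0" using assms by (simp add: zero_less_mult_iff)
  then have "real (nat n) = real_of_int n" "nat n \<ge> 1" by auto
  moreover have "E = (real_of_int n - 1 / 2) * hbar" using n by (simp add: algebra_simps)
  ultimately show "E \<in> {(real n - 1 / 2) * hbar | n :: nat. n \<ge> 1}" by force
next
  fix E assume "E \<in> {(real n - 1 / 2) * hbar | n :: nat. n \<ge> 1}"
  then obtain n :: nat where n: "n \<ge> 1" "E = (real n - 1 / 2) * hbar" by blast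
  \<comment> \<open>The criterion depends only on \<open>E\<close>, \<open>\<kappa>\<close> and
    \<open>hbar\<close>, so any nonzero odd class serves; one of degree 1 is taken. The matching
    \<open>\<kappa>\<close> is \<open>E + hbar / 2\<close>, that is
    \<open>real n * hbar\<close>.\<close>
  obtain \<alpha> where \<alpha>: "\<alpha> \<in> carrier (homology (2 * 0 + 1)) - {\<one>\<^bsub>homology (2 * 0 + 1)\<^esub>}"
    using homology_odd_nontrivial[of 0] by blast
  have "E - real n * hbar + hbar / 2 = 0" using n by (simp add: algebra_simps)
  moreover have "real n * hbar = real_of_int (int n) * hbar" by simp
  ultimately have "well_defined_spectral_number hbar E (real n * hbar) \<alpha>"
    unfolding well_defined_spectral_number_iff[OF \<alpha>] by blast
  moreover have "E > 0" "real n * hbar > 0" using n assms by simp_all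
  ultimately show "E \<in> {E. quantized_energy_value hbar E}"
    unfolding quantized_energy_value_def using \<alpha> by blast
qed

end
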